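(* Let $\mathfrak G$ be a gracefully labelled loop-graph of order $n\ge 4$ and let $M$ be an $n\times n$ Hermitian matrix. For $k=0,\dots,n-1$ define \[ M_k=M\circ\left(C_n^{\,k}\left(J_n-A_{\mathfrak G}\circ(J_n+I_n)\right)C_n^{-k}\right), \] and let $\theta_0\ge\theta_1\ge\dots\ge\theta_{n^2-1}$ be the multiset of all $n^2$ eigenvalues (with multiplicity) of $M_0,\dots,M_{n-1}$ arranged in nonincreasing order. Then for $\ell=0,\dots,n-1$, \[ \frac{n}{n-2}\,\theta_{\ell+(n^2-n)}\le\lambda_\ell(M)\le\frac{n}{n-2}\,\theta_\ell . \]
   Context: For a Hermitian matrix $M$, $\lambda_0(M)\ge\lambda_1(M)\ge\dots\ge\lambda_{n-1}(M)$ are its eigenvalues. $\circ$ is the entrywise product, $J_n$ the all-ones matrix, $C_n$ the $n\times n$ cyclic permutation matrix with $C_n\mathbf e_i=\mathbf e_{i+1\bmod n}$ (indices from $0$). A loop-graph is an undirected graph with loops allowed but no multiple edges; $A_{\mathfrak G}$ is its 0-1 adjacency matrix. A gracefully labelled loop-graph of order $n$ is a loop-graph on vertex set $\{0,\dots,n-1\}$ with exactly $n$ edges ($n-1$ non-loop edges and one loop) such that the values $|i-j|$ over its edges $\{i,j\}$ are exactly $0,1,\dots,n-1$ (each once; the loop gives $0$). *)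

theory Defs
  imports
    "HOL-Library.Multiset"
    "HOL-Computational_Algebra.Polynomial"
    "Jordan_Normal_Form.Char_Poly"
    "Jordan_Normal_Form.Gauss_Jordan_Elimination"
    "Jordan_Normal_Form.Schur_Decomposition"
begin

definition hermitian_mat :: "complex mat \<Rightarrow> bool" where
  "hermitian_mat A \<longleftrightarrow> mat_adjoint A = A"

lemma hermitian_mat_index:
  assumes "hermitian_mat A" "A \<in> carrier_mat n n" "i < n" "j < n"
  shows "A $$ (i, j) = cnj (A $$ (j, i))"
proof -
  have "A $$ (i, j) = mat_adjoint A $$ (i, j)"
    using assms(1) by (simp add: hermitian_mat_def)
  also have "\<dots> = cnj (A $$ (j, i))"
    using assms(2-4) by (simp add: mat_adjoint_def mat_of_rows_index)
  finally show ?thesis .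
qed

text \<open>Eigenvalues with multiplicity are the roots of the characteristic polynomial with
  multiplicity. Both functions below are meant for Hermitian matrices only, whose eigenvalues are
  real, so that taking real parts merely changes the type (see the lemma
  \<open>hermitian_eigvals\<close>).\<close>

definition eigvals_mset :: "complex mat \<Rightarrow> real multiset" where
  "eigvals_mset A = image_mset Re (proots (char_poly A))"

definition decreasing_list :: "real multiset \<Rightarrow> real list" where
  "decreasing_list X = rev (sorted_list_of_multiset X)"

definition eigval :: "nat \<Rightarrow> complex mat \<Rightarrow> real" where
  "eigval l A = decreasing_list (eigvals_mset A) ! l"

lemma hermitian_eigenvalue_real:
  assumes A: "A \<in> carrier_mat n n" and h: "hermitian_mat A" and e: "eigenvalue A e"
  shows "Im e = 0"
proof -
  obtain v where v: "v \<in> carrier_vec n" "v \<noteq> 0\<^sub>v n" "A *\<^sub>v v = e \<cdot>\<^sub>v v"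
    using e A by (auto simp: eigenvalue_def eigenvector_def)
  define s where "s = (\<Sum>i<n. \<Sum>j<n. A $$ (i, j) * v $ j * cnj (v $ i))"
  define q where "q = (\<Sum>i<n. v $ i * cnj (v $ i))"
  have row: "(\<Sum>j<n. A $$ (i, j) * v $ j) = e * v $ i" if "i < n" for i
  proof -
    have "(A *\<^sub>v v) $ i = e * v $ i" using v that by simp
    moreover have "(A *\<^sub>v v) $ i = (\<Sum>j<n. A $$ (i, j) * v $ j)"
      using A v(1) that by (simp add: scalar_prod_def lessThan_atLeast0)
    ultimately show ?thesis by simp
  qed
  have "s = (\<Sum>i<n. (\<Sum>j<n. A $$ (i, j) * v $ j) * cnj (v $ i))"
    unfolding s_def by (simp only: sum_distrib_right)
  also have "\<dots> = (\<Sum>i<n. e * (v $ i * cnj (v $ i)))"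
    by (intro sum.cong refl) (simp add: row)
  finally have seq: "s = e * q"
    unfolding q_def by (simp only: sum_distrib_left)
  have "cnj s = (\<Sum>i<n. \<Sum>j<n. A $$ (j, i) * cnj (v $ j) * v $ i)"
    unfolding s_def cnj_sum
  proof (intro sum.cong refl)
    fix i j assume "i \<in> {..<n}" "j \<in> {..<n}"
    hence "A $$ (j, i) = cnj (A $$ (i, j))" by (intro hermitian_mat_index[OF h A]) auto
    thus "cnj (A $$ (i, j) * v $ j * cnj (v $ i)) = A $$ (j, i) * cnj (v $ j) * v $ i"
      by (simp only: complex_cnj_mult complex_cnj_cnj)
  qed
  also have "\<dots> = s"
    unfolding s_def by (subst sum.swap) (simp only: mult_ac)
  finally have sreal: "Im s = 0" by (simp add: complex_eq_iff)
  have qq: "q = of_real (\<Sum>i<n. (cmod (v $ i))\<^sup>2)"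
    unfolding q_def by (simp add: complex_norm_square[symmetric] flip: of_real_power)
  obtain i where i: "i < n" "v $ i \<noteq> 0"
    using v by (metis carrier_vecD eq_vecI index_zero_vec)
  have "(\<Sum>i<n. (cmod (v $ i))\<^sup>2) > 0"
    by (rule sum_pos2[of _ i]) (use i in auto)
  with sreal seq qq show ?thesis by auto
qed

lemma hermitian_eigvals:
  assumes A: "A \<in> carrier_mat n n" and h: "hermitian_mat A"
  shows "image_mset complex_of_real (eigvals_mset A) = proots (char_poly A)"
proof -
  have nz: "char_poly A \<noteq> 0" using degree_monic_char_poly[OF A] by auto
  have "complex_of_real (Re e) = e" if "e \<in># proots (char_poly A)" for e
    using that nz hermitian_eigenvalue_real[OF A h] eigenvalue_root_char_poly[OF A]
    by (auto simp: complex_eq_iff)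
  hence "image_mset (\<lambda>e. complex_of_real (Re e)) (proots (char_poly A)) =
         image_mset (\<lambda>e. e) (proots (char_poly A))"
    by (intro image_mset_cong)
  thus ?thesis by (simp add: eigvals_mset_def multiset.map_comp o_def)
qed

lemma mset_decreasing_list: "mset (decreasing_list X) = X"
  by (simp add: decreasing_list_def)

lemma sorted_decreasing_list: "sorted_wrt (\<ge>) (decreasing_list X)"
  by (simp add: decreasing_list_def sorted_wrt_rev)

definition entrywise_prod :: "complex mat \<Rightarrow> complex mat \<Rightarrow> complex mat" (infixl "\<circ>\<^sub>m" 70) where
  "A \<circ>\<^sub>m B = mat (dim_row A) (dim_col A) (\<lambda>ij. A $$ ij * B $$ ij)"

definition ones_mat :: "nat \<Rightarrow> complex mat" where
  "ones_mat n = mat n n (\<lambda>_. 1)"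

definition cyclic_mat :: "nat \<Rightarrow> complex mat" where
  "cyclic_mat n = mat n n (\<lambda>(r, c). if r = (c + 1) mod n then 1 else 0)"

lemma cyclic_mat_unit_vec:
  assumes "i < n"
  shows "cyclic_mat n *\<^sub>v unit_vec n i = unit_vec n ((i + 1) mod n)"
  using assms by (intro eq_vecI) (auto simp: cyclic_mat_def)

text \<open>A loop-graph on \<open>{0..<n}\<close> is given by its set of edges; the edge joining \<open>i\<close> and \<open>j\<close> is the
  set \<open>{i, j}\<close>, so that a loop at \<open>i\<close> is the singleton \<open>{i}\<close>.\<close>

definition loop_graph :: "nat \<Rightarrow> nat set set \<Rightarrow> bool" where
  "loop_graph n E \<longleftrightarrow> (\<forall>e\<in>E. \<exists>i<n. \<exists>j<n. e = {i, j})"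

definition adjacency_mat :: "nat \<Rightarrow> nat set set \<Rightarrow> complex mat" where
  "adjacency_mat n E = mat n n (\<lambda>(i, j). if {i, j} \<in> E then 1 else 0)"

definition edge_label :: "nat set \<Rightarrow> nat" where
  "edge_label e = Max e - Min e"

lemma edge_label_eq: "int (edge_label {i, j}) = \<bar>int i - int j\<bar>"
  by (auto simp: edge_label_def max_def min_def)

definition graceful_loop_graph :: "nat \<Rightarrow> nat set set \<Rightarrow> bool" where
  "graceful_loop_graph n E \<longleftrightarrow>
     loop_graph n E \<and> card E = n \<and>
     card {e \<in> E. card e = 2} = n - 1 \<and> card {e \<in> E. card e = 1} = 1 \<and>
     bij_betw edge_label E {0..n - 1}"

text \<open>The negative power \<open>C\<^sup>-\<^sup>k\<close> is the inverse of \<open>C\<^sup>k\<close>; the option returned by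
  \<open>mat_inverse\<close> is never \<open>None\<close> here.\<close>

definition masked_mat :: "nat \<Rightarrow> nat set set \<Rightarrow> complex mat \<Rightarrow> nat \<Rightarrow> complex mat" where
  "masked_mat n E M k =
     M \<circ>\<^sub>m (cyclic_mat n ^\<^sub>m k *
           (ones_mat n - adjacency_mat n E \<circ>\<^sub>m (ones_mat n + 1\<^sub>m n)) *
           the (mat_inverse (cyclic_mat n ^\<^sub>m k)))"

definition pooled_eigval :: "nat \<Rightarrow> nat set set \<Rightarrow> complex mat \<Rightarrow> nat \<Rightarrow> real" where
  "pooled_eigval n E M l =
     decreasing_list (\<Sum>k<n. eigvals_mset (masked_mat n E M k)) ! l"

lemma cyclic_mat_pow_inverse:
  "\<exists>B. mat_inverse (cyclic_mat n ^\<^sub>m k) = Some B \<and> B \<in> carrier_mat n n \<and>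
       cyclic_mat n ^\<^sub>m k * B = 1\<^sub>m n \<and> B * cyclic_mat n ^\<^sub>m k = 1\<^sub>m n"
proof -
  let ?C = "cyclic_mat n" and ?T = "transpose_mat (cyclic_mat n)"
  have C: "?C \<in> carrier_mat n n" by (simp add: cyclic_mat_def)
  have T: "?T \<in> carrier_mat n n" using C by simp
  have inj: "i = j" if "(i + 1) mod n = (j + 1) mod n" "i < n" "j < n" for i j
    using that by (cases "i + 1 = n"; cases "j + 1 = n") auto
  have TC: "?T * ?C = 1\<^sub>m n"
  proof (rule eq_matI)
    fix i j assume ij: "i < dim_row (1\<^sub>m n :: complex mat)" "j < dim_col (1\<^sub>m n :: complex mat)"
    have "(?T * ?C) $$ (i, j) =
          (\<Sum>r<n. if r = (i + 1) mod n then if r = (j + 1) mod n then 1 else 0 else 0)"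
    proof -
      have "(?T * ?C) $$ (i, j) = (\<Sum>r<n. ?C $$ (r, i) * ?C $$ (r, j))"
        using ij C by (simp add: scalar_prod_def lessThan_atLeast0)
      also have "\<dots> = (\<Sum>r<n. if r = (i + 1) mod n then if r = (j + 1) mod n then 1 else 0 else 0)"
        using ij by (intro sum.cong refl) (simp add: cyclic_mat_def)
      finally show ?thesis .
    qed
    also have "\<dots> = (if (i + 1) mod n = (j + 1) mod n then 1 else 0)"
      using ij by (subst sum.delta) auto
    also have "\<dots> = 1\<^sub>m n $$ (i, j)"
      using ij inj[of i j] by auto
    finally show "(?T * ?C) $$ (i, j) = 1\<^sub>m n $$ (i, j)" .
  qed (simp_all add: cyclic_mat_def)
  hence CT: "?C * ?T = 1\<^sub>m n" using mat_mult_left_right_inverse[OF T C] by simp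
  have det: "det (?C ^\<^sub>m k) \<noteq> 0"
  proof -
    have "det ?T * det ?C = 1" using det_mult[OF T C] TC by simp
    hence "det ?C \<noteq> 0" by auto
    moreover have "det (?C ^\<^sub>m k) = det ?C ^ k"
    proof (induction k)
      case (Suc k)
      have "?C ^\<^sub>m k \<in> carrier_mat n n" using C by simp
      from det_mult[OF this C] Suc show ?case by simp
    qed (use C in simp)
    ultimately show ?thesis by simp
  qed
  have Ck: "?C ^\<^sub>m k \<in> carrier_mat n n" using C by simp
  have "?C ^\<^sub>m k \<in> Units (ring_mat TYPE(complex) n ())"
    using det_non_zero_imp_unit[OF Ck det] .
  with mat_inverse(1)[OF Ck, where b = "()"] have "mat_inverse (?C ^\<^sub>m k) \<noteq> None"
    by metis
  then obtain B where "mat_inverse (?C ^\<^sub>m k) = Some B"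
    by auto
  with mat_inverse(2)[OF Ck this] show ?thesis by blast
qed

end

theory Submission
  imports Defs
begin

text \<open>
  Summing the masks over all cyclic shifts gives \<open>(n - 2) J\<close>: on each cyclic diagonal
  \<open>{(i, i + d mod n)}\<close> with \<open>d \<noteq> 0\<close> lie exactly two entries of the adjacency matrix, one from the
  edge labelled \<open>d\<close> and one from the edge labelled \<open>n - d\<close>, while on the main diagonal the single
  loop is counted twice. Hence \<open>\<Sum>\<^sub>k M\<^sub>k = (n - 2) M\<close>, and the claim is an interlacing
  statement about a sum of Hermitian matrices. For the upper bound, put \<open>t = \<theta>\<^sub>l\<close> and
  \<open>s = \<lambda>\<^sub>l(M)\<close>. At most \<open>l\<close> eigenvectors of the \<open>M\<^sub>k\<close> have an eigenvalue above \<open>t\<close>, and at most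
  \<open>n - 1 - l\<close> eigenvectors of \<open>M\<close> have an eigenvalue below \<open>s\<close>. Some \<open>x \<noteq> 0\<close> is orthogonal to
  all of them, and for it \<open>(n - 2) s |x|\<^sup>2 \<le> (n - 2) x\<^sup>* M x = \<Sum>\<^sub>k x\<^sup>* M\<^sub>k x \<le> n t |x|\<^sup>2\<close>.
  The lower bound is symmetric.
\<close>

section \<open>Unitary diagonalization of Hermitian matrices\<close>

lemma mat_adjoint_carrier [simp]: "A \<in> carrier_mat nr nc \<Longrightarrow> mat_adjoint A \<in> carrier_mat nc nr"
  by (auto simp: mat_adjoint_def)

lemma mat_adjoint_dim [simp]:
  "dim_row (mat_adjoint A) = dim_col A" "dim_col (mat_adjoint A) = dim_row A"
  by (auto simp: mat_adjoint_def)

lemma mat_adjoint_index: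
  "i < dim_col A \<Longrightarrow> j < dim_row A \<Longrightarrow> mat_adjoint A $$ (i, j) = conjugate (A $$ (j, i))"
  by (simp add: mat_adjoint_def mat_of_rows_index)

lemma mat_adjoint_adjoint [simp]: "mat_adjoint (mat_adjoint A) = A"
  by (rule eq_matI) (auto simp: mat_adjoint_index)

lemma mat_adjoint_mult:
  fixes A B :: "complex mat"
  assumes "A \<in> carrier_mat nr n" "B \<in> carrier_mat n nc"
  shows "mat_adjoint (A * B) = mat_adjoint B * mat_adjoint A"
proof (rule eq_matI)
  fix i j
  assume "i < dim_row (mat_adjoint B * mat_adjoint A)"
    and "j < dim_col (mat_adjoint B * mat_adjoint A)"
  hence ij: "i < nc" "j < nr" using assms by auto
  have "mat_adjoint (A * B) $$ (i, j) = (\<Sum>k<n. cnj (A $$ (j, k)) * cnj (B $$ (k, i)))"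
    using assms ij by (simp add: mat_adjoint_index scalar_prod_def lessThan_atLeast0)
  also have "\<dots> = (\<Sum>k<n. cnj (B $$ (k, i)) * cnj (A $$ (j, k)))"
    by (simp add: mult.commute)
  also have "\<dots> = (mat_adjoint B * mat_adjoint A) $$ (i, j)"
    using assms ij by (simp add: mat_adjoint_index scalar_prod_def lessThan_atLeast0)
  finally show "mat_adjoint (A * B) $$ (i, j) = (mat_adjoint B * mat_adjoint A) $$ (i, j)" .
qed (use assms in auto)

lemma mat_adjoint_four_block:
  fixes A B C D :: "complex mat"
  assumes "A \<in> carrier_mat nr1 nc1" "B \<in> carrier_mat nr1 nc2"
    "C \<in> carrier_mat nr2 nc1" "D \<in> carrier_mat nr2 nc2"
  shows "mat_adjoint (four_block_mat A B C D) =
    four_block_mat (mat_adjoint A) (mat_adjoint C) (mat_adjoint B) (mat_adjoint D)"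
  using assms by (intro eq_matI) (simp_all add: mat_adjoint_index)

lemma hermitian_matI:
  assumes "A \<in> carrier_mat n n"
    and "\<And>i j. i < n \<Longrightarrow> j < n \<Longrightarrow> A $$ (i, j) = cnj (A $$ (j, i))"
  shows "hermitian_mat A"
  unfolding hermitian_mat_def
  using assms(1) by (intro eq_matI) (auto simp: mat_adjoint_index assms(2)[symmetric])

text \<open>Completing \<open>v\<close> to a basis and applying Gram-Schmidt gives pairwise
  orthogonal vectors beginning with \<open>v\<close>; dividing each by its norm makes them
  orthonormal columns. The scalar \<open>c\<close> obtained is the reciprocal norm of
  \<open>v\<close>.\<close>

lemma exists_unitary_first_col:
  fixes v :: "complex vec"
  assumes v: "v \<in> carrier_vec n" and v0: "v \<noteq> 0\<^sub>v n" and n: "0 < n"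
  shows "\<exists>U c. U \<in> carrier_mat n n \<and> mat_adjoint U * U = 1\<^sub>m n \<and> col U 0 = c \<cdot>\<^sub>v v"
proof -
  interpret cof_vec_space n "TYPE(complex)" .
  define b where "b = basis_completion v"
  define ws where "ws = gram_schmidt n b"
  define nrm where "nrm w = complex_of_real (1 / sqrt (Re (w \<bullet>c w)))" for w
  have cnj_nrm: "cnj (nrm w) = nrm w" for w by (simp add: nrm_def)
  from basis_completion[OF v v0, folded b_def]
  have dist_b: "distinct b" and indep: "\<not> lin_dep (set b)" and b: "set b \<subseteq> carrier_vec n"
    and hdb: "hd b = v" and len_b: "length b = n" by auto
  from hdb len_b n obtain vs where bv: "b = v # vs" by (cases b, auto)
  from gram_schmidt_result[OF b dist_b indep refl, folded ws_def]
  have ws: "set ws \<subseteq> carrier_vec n" "corthogonal ws" "length ws = n"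
    by (auto simp: len_b)
  have "hd ws = v" using gram_schmidt_hd[OF v, of vs, folded bv] by (simp add: ws_def)
  hence ws0: "ws ! 0 = v" using ws(3) n by (cases ws) auto
  have wsi: "ws ! i \<in> carrier_vec n" if "i < n" for i using ws that by auto
  define U where "U = mat_of_cols n (map (\<lambda>w. nrm w \<cdot>\<^sub>v w) ws)"
  have U: "U \<in> carrier_mat n n" unfolding U_def using ws by (auto intro: mat_of_cols_carrier)
  have colU: "col U i = nrm (ws ! i) \<cdot>\<^sub>v (ws ! i)" if "i < n" for i
    unfolding U_def using that ws wsi by (subst col_mat_of_cols) auto
  have "mat_adjoint U * U = 1\<^sub>m n"
  proof (rule eq_matI)
    fix i j assume "i < dim_row (1\<^sub>m n :: complex mat)" "j < dim_col (1\<^sub>m n :: complex mat)"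
    hence ij: "i < n" "j < n" by auto
    have "(mat_adjoint U * U) $$ (i, j) = col U j \<bullet>c col U i"
      using ij U by (auto simp: scalar_prod_def mat_adjoint_index mult.commute intro!: sum.cong)
    also have "\<dots> = nrm (ws ! j) * nrm (ws ! i) * (ws ! j \<bullet>c ws ! i)"
      using wsi[OF ij(1)] wsi[OF ij(2)] unfolding colU[OF ij(1)] colU[OF ij(2)]
      by (simp add: scalar_prod_def sum_distrib_left cnj_nrm mult_ac)
    also have "\<dots> = (if i = j then 1 else 0)"
    proof (cases "i = j")
      case True
      have "ws ! i \<bullet>c ws ! i \<noteq> 0" using corthogonalD[OF ws(2)] ij ws(3) by auto
      moreover have "ws ! i \<bullet>c ws ! i \<ge> 0" by auto
      \<comment> \<open>In the order on complex numbers, being nonnegative includes being real, so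
        the squared norm is a positive real \<open>r\<close>, and the two factors \<open>nrm\<close>
        cancel it exactly.\<close>
      ultimately obtain r where r: "ws ! i \<bullet>c ws ! i = complex_of_real r" "r > 0"
        by (intro that[of "Re (ws ! i \<bullet>c ws ! i)"]) (auto simp: less_eq_complex_def complex_eq_iff)
      have "complex_of_real (sqrt r) * complex_of_real (sqrt r) = complex_of_real r"
        using r(2) by (simp flip: of_real_mult)
      thus ?thesis using True r by (simp add: nrm_def field_simps)
    next
      case False
      thus ?thesis using corthogonalD[OF ws(2)] ij ws(3) by auto
    qed
    finally show "(mat_adjoint U * U) $$ (i, j) = 1\<^sub>m n $$ (i, j)" using ij by simp
  qed (use U in auto)
  with U colU[OF n, unfolded ws0] show ?thesis by blast
qed

lemma hermitian_mat_conj: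
  assumes "hermitian_mat A" and A: "A \<in> carrier_mat n n" and U: "U \<in> carrier_mat n m"
  shows "hermitian_mat (mat_adjoint U * A * U)"
proof -
  have U': "mat_adjoint U \<in> carrier_mat m n" using U by simp
  have "mat_adjoint (mat_adjoint U * A * U) = mat_adjoint U * mat_adjoint (mat_adjoint U * A)"
    using mat_adjoint_mult[OF mult_carrier_mat[OF U' A] U] .
  also have "mat_adjoint (mat_adjoint U * A) = A * U"
    using mat_adjoint_mult[OF U' A] assms(1) by (simp add: hermitian_mat_def)
  also have "mat_adjoint U * (A * U) = mat_adjoint U * A * U"
    using assoc_mult_mat[OF U' A U] by simp
  finally show ?thesis by (simp add: hermitian_mat_def)
qed

text \<open>Serves twice when unitaries are composed: with \<open>A\<close> the matrix to be
  diagonalized, and with \<open>A\<close> the identity, where it shows that the product is unitary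
  again.\<close>

lemma mat_adjoint_conj_mult:
  fixes A U W :: "complex mat"
  assumes A: "A \<in> carrier_mat n n" and U: "U \<in> carrier_mat n n" and W: "W \<in> carrier_mat n n"
  shows "mat_adjoint (U * W) * A * (U * W) = mat_adjoint W * (mat_adjoint U * A * U) * W"
proof -
  define U' W' where "U' = mat_adjoint U" and "W' = mat_adjoint W"
  have c: "U' \<in> carrier_mat n n" "W' \<in> carrier_mat n n" using U W by (simp_all add: U'_def W'_def)
  show ?thesis
    unfolding mat_adjoint_mult[OF U W] U'_def[symmetric] W'_def[symmetric]
    using A U W c by (simp add: assoc_mult_mat[of _ n n _ n _ n])
qed

text \<open>By induction on the dimension. In a unitary basis that starts with an eigenvector, the
  first column is \<open>e\<close> times a unit vector; Hermitian symmetry clears the first row as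
  well, and the complementary block is Hermitian of dimension one less.\<close>

theorem hermitian_diagonalization:
  assumes "A \<in> carrier_mat n n" "hermitian_mat A"
  shows "\<exists>U D. U \<in> carrier_mat n n \<and> D \<in> carrier_mat n n \<and> mat_adjoint U * U = 1\<^sub>m n \<and>
    diagonal_mat D \<and> mat_adjoint U * A * U = D"
  using assms
proof (induction n arbitrary: A)
  case 0
  show ?case
    by (rule exI[of _ "1\<^sub>m 0"], rule exI[of _ "0\<^sub>m 0 0"])
      (use 0 in \<open>auto intro!: eq_matI simp: diagonal_mat_def\<close>)
next
  case (Suc m A)
  let ?n = "Suc m"
  note A = Suc.prems(1) and H = Suc.prems(2)
  have "degree (char_poly A) = ?n" using degree_monic_char_poly[OF A] by simp
  hence "\<not> constant (poly (char_poly A))" by (simp add: constant_degree)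
  then obtain e where "poly (char_poly A) e = 0"
    using fundamental_theorem_of_algebra by blast
  hence "eigenvalue A e" using eigenvalue_root_char_poly[OF A] by simp
  then obtain v where v: "v \<in> carrier_vec ?n" "v \<noteq> 0\<^sub>v ?n" "A *\<^sub>v v = e \<cdot>\<^sub>v v"
    using A by (auto simp: eigenvalue_def eigenvector_def)
  obtain U c where U: "U \<in> carrier_mat ?n ?n" and UU: "mat_adjoint U * U = 1\<^sub>m ?n"
    and U0: "col U 0 = c \<cdot>\<^sub>v v"
    using exists_unitary_first_col[OF v(1,2)] by auto
  let ?U = "mat_adjoint U"
  have U': "?U \<in> carrier_mat ?n ?n" using U by simp
  define B where "B = ?U * A * U"
  have B: "B \<in> carrier_mat ?n ?n" using A U by (auto simp: B_def)
  have HB: "hermitian_mat B" unfolding B_def using hermitian_mat_conj[OF H A U] .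
  \<comment> \<open>Column 0 of \<open>U\<close> is a multiple of the eigenvector \<open>v\<close>.
    The adjoint of \<open>U\<close> sends it to the first unit vector, which determines column 0 of
    \<open>B\<close>.\<close>
  have "A *\<^sub>v col U 0 = e \<cdot>\<^sub>v col U 0"
    unfolding U0 using A v by (auto simp: mult_mat_vec smult_smult_assoc mult.commute)
  moreover have "col B 0 = ?U *\<^sub>v (A *\<^sub>v col U 0)"
  proof -
    have "col B 0 = ?U * A *\<^sub>v col U 0"
      unfolding B_def by (rule col_mult2[OF mult_carrier_mat[OF U' A] U]) simp
    also have "\<dots> = ?U *\<^sub>v (A *\<^sub>v col U 0)"
      by (rule assoc_mult_mat_vec[OF U' A col_carrier_vec[OF _ U]]) simp
    finally show ?thesis .
  qed
  ultimately have "col B 0 = e \<cdot>\<^sub>v (?U *\<^sub>v col U 0)"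
    using U U' by (metis col_carrier_vec mult_mat_vec zero_less_Suc)
  also have "?U *\<^sub>v col U 0 = col (1\<^sub>m ?n) 0"
    unfolding UU[symmetric] using U U' by (simp add: col_mult2[of _ ?n ?n _ ?n])
  finally have colB: "col B 0 = e \<cdot>\<^sub>v col (1\<^sub>m ?n) 0" .
  have B0: "B $$ (i, 0) = (if i = 0 then e else 0)" if "i < ?n" for i
  proof -
    have "B $$ (i, 0) = col B 0 $ i" using that B by simp
    thus ?thesis unfolding colB using that by simp
  qed
  have B0': "B $$ (0, i) = (if i = 0 then e else 0)" if "i < ?n" for i
    using hermitian_mat_index[OF HB B, of 0 i] B0[of 0] B0[OF that] that by auto
  define B3 where "B3 = mat m m (\<lambda>(i, j). B $$ (Suc i, Suc j))"
  have B3: "B3 \<in> carrier_mat m m" by (simp add: B3_def)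
  have "hermitian_mat B3"
  proof (rule hermitian_matI[OF B3])
    fix i j assume "i < m" "j < m"
    thus "B3 $$ (i, j) = cnj (B3 $$ (j, i))"
      using hermitian_mat_index[OF HB B, of "Suc i" "Suc j"] by (simp add: B3_def)
  qed
  from Suc.IH[OF B3 this] obtain V D where V: "V \<in> carrier_mat m m" and D: "D \<in> carrier_mat m m"
    and VV: "mat_adjoint V * V = 1\<^sub>m m" and dD: "diagonal_mat D"
    and VD: "mat_adjoint V * B3 * V = D" by blast
  let ?e = "mat 1 1 (\<lambda>_. e)"
  let ?blk = "\<lambda>X Y. four_block_mat X (0\<^sub>m 1 m) (0\<^sub>m m 1) (Y :: complex mat)"
  \<comment> \<open>\<open>V\<close> diagonalizes the lower block; bordered by 1 it leaves the first
    coordinate alone, so \<open>U * ?W\<close> diagonalizes \<open>A\<close>.\<close>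
  let ?W = "?blk (1\<^sub>m 1) V" and ?W' = "?blk (1\<^sub>m 1) (mat_adjoint V)"
  have Bblk: "B = ?blk ?e B3"
    using B B0 B0' by (intro eq_matI) (auto simp: B3_def)
  have W: "?W \<in> carrier_mat ?n ?n" using V by auto
  have adj: "mat_adjoint (1\<^sub>m 1 :: complex mat) = 1\<^sub>m 1"
    "mat_adjoint (0\<^sub>m 1 m :: complex mat) = 0\<^sub>m m 1"
    "mat_adjoint (0\<^sub>m m 1 :: complex mat) = 0\<^sub>m 1 m"
    by (intro eq_matI; auto simp: mat_adjoint_index)+
  have W': "mat_adjoint ?W = ?W'"
    using V by (subst mat_adjoint_four_block[of _ 1 1 _ m _ m]) (simp_all add: adj[simplified])
  have mult_blk: "?blk X Y * ?blk X' Y' = ?blk (X * X') (Y * Y')"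
    if "X \<in> carrier_mat 1 1" "X' \<in> carrier_mat 1 1" "Y \<in> carrier_mat m m" "Y' \<in> carrier_mat m m"
    for X X' Y Y'
    using that by (subst mult_four_block_mat[of _ 1 1 _ m _ m _ _ 1 _ m]) auto
  have WW: "mat_adjoint ?W * ?W = 1\<^sub>m ?n"
    unfolding W' using V VV by (subst mult_blk) auto
  have V': "mat_adjoint V \<in> carrier_mat m m" using V by simp
  have WBW: "mat_adjoint ?W * B * ?W = ?blk ?e D"
    unfolding W' Bblk
    using V' V B3 VD by (subst mult_blk, simp, simp, simp, simp, subst mult_blk) auto
  let ?UW = "U * ?W"
  have "mat_adjoint ?UW * 1\<^sub>m ?n * ?UW = 1\<^sub>m ?n"
    unfolding mat_adjoint_conj_mult[OF one_carrier_mat U W] right_mult_one_mat[OF U'] UU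
      right_mult_one_mat[OF mat_adjoint_carrier[OF W]] by (rule WW)
  hence 1: "mat_adjoint ?UW * ?UW = 1\<^sub>m ?n"
    unfolding right_mult_one_mat[OF mat_adjoint_carrier[OF mult_carrier_mat[OF U W]]] .
  have 2: "mat_adjoint ?UW * A * ?UW = ?blk ?e D"
    unfolding mat_adjoint_conj_mult[OF A U W] B_def[symmetric] by (rule WBW)
  have 3: "diagonal_mat (?blk ?e D)"
    using dD D by (auto simp: diagonal_mat_def)
  have 4: "?UW \<in> carrier_mat ?n ?n" using U W by (rule mult_carrier_mat)
  have 5: "?blk ?e D \<in> carrier_mat ?n ?n" using D by auto
  show ?case using 1 2 3 4 5 by blast
qed

section \<open>Interlacing for sums of Hermitian matrices\<close>

lemma mult_mat_vec_cscalar_prod: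
  fixes A :: "complex mat"
  assumes A: "A \<in> carrier_mat n m" and y: "y \<in> carrier_vec m" and x: "x \<in> carrier_vec n"
  shows "(A *\<^sub>v y) \<bullet>c x = y \<bullet>c (mat_adjoint A *\<^sub>v x)"
proof -
  have "(A *\<^sub>v y) \<bullet>c x = (\<Sum>i<n. \<Sum>j<m. A $$ (i, j) * y $ j * cnj (x $ i))"
    using assms by (simp add: scalar_prod_def lessThan_atLeast0 sum_distrib_right)
  also have "\<dots> = (\<Sum>j<m. \<Sum>i<n. A $$ (i, j) * y $ j * cnj (x $ i))"
    by (rule sum.swap)
  also have "\<dots> = y \<bullet>c (mat_adjoint A *\<^sub>v x)"
    using assms
    by (simp add: scalar_prod_def lessThan_atLeast0 sum_distrib_left mat_adjoint_index mult_ac)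
  finally show ?thesis .
qed

text \<open>The vectors \<open>q i\<close> are the rows of the adjoint of the diagonalizing unitary,
  that is, conjugated orthonormal eigenvectors. With this choice the coordinates of \<open>x\<close>
  are the bilinear products \<open>q i \<bullet> x\<close>, so orthogonality to eigenvectors becomes
  a system of ordinary linear equations. The values \<open>d i\<close> come in no particular
  order.\<close>

lemma hermitian_spectral_form:
  assumes A: "A \<in> carrier_mat n n" and H: "hermitian_mat A"
  obtains q :: "nat \<Rightarrow> complex vec" and d :: "nat \<Rightarrow> real" where
    "\<And>i. i < n \<Longrightarrow> q i \<in> carrier_vec n"
    "eigvals_mset A = mset (map d [0..<n])"
    "\<And>x. x \<in> carrier_vec n \<Longrightarrow> Re ((A *\<^sub>v x) \<bullet>c x) = (\<Sum>i<n. d i * (cmod (q i \<bullet> x))\<^sup>2)"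
    "\<And>x. x \<in> carrier_vec n \<Longrightarrow> Re (x \<bullet>c x) = (\<Sum>i<n. (cmod (q i \<bullet> x))\<^sup>2)"
proof -
  obtain U D where U: "U \<in> carrier_mat n n" and D: "D \<in> carrier_mat n n"
    and VU: "mat_adjoint U * U = 1\<^sub>m n" and dD: "diagonal_mat D"
    and VAU: "mat_adjoint U * A * U = D"
    using hermitian_diagonalization[OF A H] by blast
  define V where "V = mat_adjoint U"
  have V: "V \<in> carrier_mat n n" using U by (simp add: V_def)
  have UV: "U * V = 1\<^sub>m n"
    using mat_mult_left_right_inverse[OF V U] VU by (simp add: V_def)
  have "U * D * V = (U * V) * A * (U * V)"
    unfolding VAU[symmetric] V_def[symmetric]
    using U V A by (simp add: assoc_mult_mat[of _ n n _ n _ n])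
  hence AUDV: "A = U * D * V" unfolding UV using A by simp
  \<comment> \<open>Similarity carries the characteristic polynomial over to \<open>D\<close>, so
    the eigenvalues of \<open>A\<close> with multiplicity are the diagonal entries of
    \<open>D\<close>.\<close>
  have "similar_mat_wit A D U V"
    by (rule similar_mat_witI[of _ _ n]) (use UV VU AUDV A D U V in \<open>auto simp: V_def\<close>)
  hence "char_poly A = char_poly D"
    by (intro char_poly_similar) (auto simp: similar_mat_def)
  also have "upper_triangular D" using dD D by (auto simp: diagonal_mat_def)
  hence "char_poly D = (\<Prod>a\<leftarrow>diag_mat D. [:- a, 1:])"
    by (rule char_poly_upper_triangular[OF D])
  finally have "char_poly A = (\<Prod>a\<leftarrow>diag_mat D. [:- a, 1:])" .
  moreover have "proots (\<Prod>a\<leftarrow>as. [:- a, 1:]) = mset as" for as :: "complex list"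
  proof (induction as)
    case (Cons a as)
    have "(\<Prod>a\<leftarrow>as. [:- a, 1:]) \<noteq> 0" by (auto simp: prod_list_zero_iff)
    hence "proots ([:- a, 1:] * (\<Prod>a\<leftarrow>as. [:- a, 1:])) = add_mset a (mset as)"
      by (subst proots_mult) (simp_all add: Cons)
    thus ?case by (simp only: list.map prod_list.Cons mset.simps)
  qed simp
  ultimately have "proots (char_poly A) = mset (diag_mat D)" by simp
  hence ev: "eigvals_mset A = mset (map (\<lambda>i. Re (D $$ (i, i))) [0..<n])"
    using D by (simp add: eigvals_mset_def diag_mat_def multiset.map_comp o_def)
  show ?thesis
  proof (rule that[of "row V" "\<lambda>i. Re (D $$ (i, i))"])
    fix x :: "complex vec" assume x: "x \<in> carrier_vec n"
    define y where "y = V *\<^sub>v x"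
    have y: "y \<in> carrier_vec n" using V x by (simp add: y_def)
    have yi: "y $ i = row V i \<bullet> x" if "i < n" for i using that V by (simp add: y_def)
    have "A *\<^sub>v x = U *\<^sub>v (D *\<^sub>v y)"
      unfolding AUDV y_def using U D V x
      by (simp add: assoc_mult_mat_vec[of _ n n _ n] assoc_mult_mat[of _ n n _ n _ n])
    hence "(A *\<^sub>v x) \<bullet>c x = (D *\<^sub>v y) \<bullet>c y"
      using mult_mat_vec_cscalar_prod[OF U _ x, of "D *\<^sub>v y"] D y by (simp add: y_def V_def)
    also have "\<dots> = (\<Sum>i<n. (\<Sum>j<n. D $$ (i, j) * y $ j) * cnj (y $ i))"
      using D y by (simp add: scalar_prod_def lessThan_atLeast0)
    also have "\<dots> = (\<Sum>i<n. D $$ (i, i) * (y $ i * cnj (y $ i)))"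
    proof (intro sum.cong refl)
      fix i assume i: "i \<in> {..<n}"
      have "(\<Sum>j<n. D $$ (i, j) * y $ j) = (\<Sum>j<n. if j = i then D $$ (i, i) * y $ i else 0)"
        using dD D i by (intro sum.cong refl) (auto simp: diagonal_mat_def)
      thus "(\<Sum>j<n. D $$ (i, j) * y $ j) * cnj (y $ i) = D $$ (i, i) * (y $ i * cnj (y $ i))"
        using i by simp
    qed
    finally have "(A *\<^sub>v x) \<bullet>c x = (\<Sum>i<n. D $$ (i, i) * (y $ i * cnj (y $ i)))" .
    thus "Re ((A *\<^sub>v x) \<bullet>c x) = (\<Sum>i<n. Re (D $$ (i, i)) * (cmod (row V i \<bullet> x))\<^sup>2)"
      by (simp add: yi complex_norm_square[symmetric] del: of_real_power flip: of_real_power)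
    have "x = U *\<^sub>v y"
      unfolding y_def using assoc_mult_mat_vec[OF U V x] x by (simp add: UV)
    hence "x \<bullet>c x = y \<bullet>c y"
      using mult_mat_vec_cscalar_prod[OF U y x] by (simp add: y_def V_def)
    also have "\<dots> = (\<Sum>i<n. y $ i * cnj (y $ i))"
      using y by (simp add: scalar_prod_def lessThan_atLeast0)
    finally show "Re (x \<bullet>c x) = (\<Sum>i<n. (cmod (row V i \<bullet> x))\<^sup>2)"
      by (simp add: yi complex_norm_square[symmetric] del: of_real_power flip: of_real_power)
  qed (use V ev in auto)
qed

text \<open>The list \<open>ws\<close> collects the conjugated eigenvectors with eigenvalue above
  \<open>t\<close>. Once \<open>x\<close> is annihilated by them, only coordinates with eigenvalue
  at most \<open>t\<close> survive in the spectral sum.\<close>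

lemma hermitian_form_le:
  assumes A: "A \<in> carrier_mat n n" and H: "hermitian_mat A"
  obtains ws where "set ws \<subseteq> carrier_vec n"
    "length ws = size {#e \<in># eigvals_mset A. t < e#}"
    "\<And>x. x \<in> carrier_vec n \<Longrightarrow> (\<And>w. w \<in> set ws \<Longrightarrow> w \<bullet> x = 0) \<Longrightarrow>
       Re ((A *\<^sub>v x) \<bullet>c x) \<le> t * Re (x \<bullet>c x)"
proof -
  obtain q d where q: "\<And>i. i < n \<Longrightarrow> q i \<in> carrier_vec n"
    and ev: "eigvals_mset A = mset (map d [0..<n])"
    and form: "\<And>x. x \<in> carrier_vec n \<Longrightarrow> Re ((A *\<^sub>v x) \<bullet>c x) = (\<Sum>i<n. d i * (cmod (q i \<bullet> x))\<^sup>2)"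
    and norm: "\<And>x. x \<in> carrier_vec n \<Longrightarrow> Re (x \<bullet>c x) = (\<Sum>i<n. (cmod (q i \<bullet> x))\<^sup>2)"
    using hermitian_spectral_form[OF A H] by blast
  let ?I = "filter (\<lambda>i. t < d i) [0..<n]"
  show ?thesis
  proof (rule that[of "map q ?I"])
    have "length (map q ?I) = length (filter (\<lambda>e. t < e) (map d [0..<n]))"
      by (simp add: filter_map o_def)
    thus "length (map q ?I) = size {#e \<in># eigvals_mset A. t < e#}"
      unfolding ev by (metis mset_filter size_mset)
    fix x :: "complex vec"
    assume x: "x \<in> carrier_vec n" and ann: "\<And>w. w \<in> set (map q ?I) \<Longrightarrow> w \<bullet> x = 0"
    have "d i * (cmod (q i \<bullet> x))\<^sup>2 \<le> t * (cmod (q i \<bullet> x))\<^sup>2" if "i < n" for i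
      using that ann[of "q i"] by (cases "t < d i") (auto intro!: mult_right_mono)
    thus "Re ((A *\<^sub>v x) \<bullet>c x) \<le> t * Re (x \<bullet>c x)"
      unfolding form[OF x] norm[OF x] sum_distrib_left by (intro sum_mono) auto
  qed (use q in auto)
qed

text \<open>The same argument with the eigenvalues below \<open>t\<close> removed.\<close>

lemma hermitian_form_ge:
  assumes A: "A \<in> carrier_mat n n" and H: "hermitian_mat A"
  obtains ws where "set ws \<subseteq> carrier_vec n"
    "length ws = size {#e \<in># eigvals_mset A. e < t#}"
    "\<And>x. x \<in> carrier_vec n \<Longrightarrow> (\<And>w. w \<in> set ws \<Longrightarrow> w \<bullet> x = 0) \<Longrightarrow>
       t * Re (x \<bullet>c x) \<le> Re ((A *\<^sub>v x) \<bullet>c x)"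
proof -
  obtain q d where q: "\<And>i. i < n \<Longrightarrow> q i \<in> carrier_vec n"
    and ev: "eigvals_mset A = mset (map d [0..<n])"
    and form: "\<And>x. x \<in> carrier_vec n \<Longrightarrow> Re ((A *\<^sub>v x) \<bullet>c x) = (\<Sum>i<n. d i * (cmod (q i \<bullet> x))\<^sup>2)"
    and norm: "\<And>x. x \<in> carrier_vec n \<Longrightarrow> Re (x \<bullet>c x) = (\<Sum>i<n. (cmod (q i \<bullet> x))\<^sup>2)"
    using hermitian_spectral_form[OF A H] by blast
  let ?I = "filter (\<lambda>i. d i < t) [0..<n]"
  show ?thesis
  proof (rule that[of "map q ?I"])
    have "length (map q ?I) = length (filter (\<lambda>e. e < t) (map d [0..<n]))"
      by (simp add: filter_map o_def)
    thus "length (map q ?I) = size {#e \<in># eigvals_mset A. e < t#}"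
      unfolding ev by (metis mset_filter size_mset)
    fix x :: "complex vec"
    assume x: "x \<in> carrier_vec n" and ann: "\<And>w. w \<in> set (map q ?I) \<Longrightarrow> w \<bullet> x = 0"
    have "t * (cmod (q i \<bullet> x))\<^sup>2 \<le> d i * (cmod (q i \<bullet> x))\<^sup>2" if "i < n" for i
      using that ann[of "q i"] by (cases "d i < t") (auto intro!: mult_right_mono)
    thus "t * Re (x \<bullet>c x) \<le> Re ((A *\<^sub>v x) \<bullet>c x)"
      unfolding form[OF x] norm[OF x] sum_distrib_left by (intro sum_mono) auto
  qed (use q in auto)
qed

section \<open>Counting eigenvalues, linear constraints and list positions\<close>

lemma size_eigvals_mset: "A \<in> carrier_mat n n \<Longrightarrow> size (eigvals_mset A) = n"
  using degree_monic_char_poly[of A n] by (simp add: eigvals_mset_def size_proots_complex)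

text \<open>Fewer than \<open>n\<close> homogeneous equations in \<open>n\<close> unknowns: padded
  with zero rows, they form a singular square matrix, which has a nonzero kernel vector.\<close>

lemma exists_nonzero_annihilated:
  fixes ws :: "'a :: field vec list"
  assumes ws: "set ws \<subseteq> carrier_vec n" and len: "length ws < n"
  obtains x where "x \<in> carrier_vec n" "x \<noteq> 0\<^sub>v n" "\<And>w. w \<in> set ws \<Longrightarrow> w \<bullet> x = 0"
proof -
  define c where "c i = (if i < length ws then ws ! i else 0\<^sub>v n)" for i
  have c: "c i \<in> carrier_vec n" for i using ws by (auto simp: c_def)
  \<comment> \<open>Row \<open>length ws\<close> is already zero by the definition of
    \<open>c\<close>; the explicit test gives the matrix the form that \<open>det_row_0\<close>
    expects.\<close>
  define A where "A = mat\<^sub>r n n (\<lambda>i. if i = length ws then 0\<^sub>v n else c i)"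
  have "det A = 0" unfolding A_def by (rule det_row_0[OF len]) (use c in auto)
  moreover have A: "A \<in> carrier_mat n n" by (simp add: A_def)
  ultimately obtain x where x: "x \<in> carrier_vec n" "x \<noteq> 0\<^sub>v n" "A *\<^sub>v x = 0\<^sub>v n"
    using det_0_iff_vec_prod_zero_field[OF A] by blast
  have "w \<bullet> x = 0" if w: "w \<in> set ws" for w
  proof -
    obtain i where i: "i < length ws" "w = ws ! i" using w by (auto simp: in_set_conv_nth)
    have "row A i = w"
      using i len c[of i] by (auto simp: A_def c_def)
    hence "w \<bullet> x = (A *\<^sub>v x) $ i" using i len A by simp
    thus ?thesis using x(3) i len by simp
  qed
  with x that show ?thesis by blast
qed

lemma decreasing_list_nth_mono:
  assumes "i \<le> j" "j < size X"
  shows "decreasing_list X ! j \<le> decreasing_list X ! i"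
proof (cases "i = j")
  case False
  have "length (decreasing_list X) = size X" by (metis mset_decreasing_list size_mset)
  thus ?thesis
    using sorted_wrt_nth_less[OF sorted_decreasing_list, of i j X] assms False by simp
qed simp

lemma size_filter_decreasing_list:
  "size (filter_mset P X) = card {i. i < size X \<and> P (decreasing_list X ! i)}"
proof -
  have "length (decreasing_list X) = size X" by (metis mset_decreasing_list size_mset)
  moreover have "size (filter_mset P X) = length (filter P (decreasing_list X))"
    by (metis mset_decreasing_list mset_filter size_mset)
  ultimately show ?thesis by (simp add: length_filter_conv_card)
qed

text \<open>Strictly larger entries can stand only at positions before \<open>i\<close>; ties may
  make their number smaller.\<close>

lemma size_greater_decreasing_list_nth:
  assumes "i < size X"
  shows "size {#e \<in># X. decreasing_list X ! i < e#} \<le> i"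
proof -
  have "{j. j < size X \<and> decreasing_list X ! i < decreasing_list X ! j} \<subseteq> {..<i}"
    using decreasing_list_nth_mono[of i _ X] by (force simp: not_le[symmetric])
  from card_mono[OF _ this] show ?thesis by (simp add: size_filter_decreasing_list)
qed

text \<open>Strictly smaller entries can stand only after position \<open>i\<close>.\<close>

lemma size_less_decreasing_list_nth:
  assumes "i < size X"
  shows "size {#e \<in># X. e < decreasing_list X ! i#} \<le> size X - Suc i"
proof -
  have "{j. j < size X \<and> decreasing_list X ! j < decreasing_list X ! i} \<subseteq> {i<..<size X}"
    using decreasing_list_nth_mono[of _ i X] assms by (force simp: not_le[symmetric])
  from card_mono[OF _ this] show ?thesis by (simp add: size_filter_decreasing_list)
qed

text \<open>Concatenates the constraint lists of the single matrices. In the application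
  \<open>Q k S\<close> bounds the form of \<open>B k\<close> on all \<open>x\<close> annihilated by
  \<open>S\<close>; enlarging \<open>S\<close> leaves fewer such \<open>x\<close>, hence
  monotonicity. The lengths add up to a count in the pooled multiset.\<close>

lemma concat_choice:
  assumes "finite K" and "\<And>k. k \<in> K \<Longrightarrow> \<exists>ws. set ws \<subseteq> C \<and> length ws = f k \<and> Q k (set ws)"
    and mono: "\<And>k S T. Q k S \<Longrightarrow> S \<subseteq> T \<Longrightarrow> Q k T"
  shows "\<exists>ws. set ws \<subseteq> C \<and> length ws = (\<Sum>k\<in>K. f k) \<and> (\<forall>k\<in>K. Q k (set ws))"
  using assms(1,2)
proof (induction K rule: finite_induct)
  case (insert k K)
  then obtain us vs where "set us \<subseteq> C" "length us = f k" "Q k (set us)"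
    "set vs \<subseteq> C" "length vs = (\<Sum>k\<in>K. f k)" "\<forall>k\<in>K. Q k (set vs)"
    by (metis insertCI)
  with insert.hyps show ?case
    by (intro exI[of _ "us @ vs"]) (auto intro: mono)
qed auto

lemma size_filter_mset_sum:
  "size (filter_mset P (\<Sum>k\<in>K. X k)) = (\<Sum>k\<in>K. size (filter_mset P (X k)))"
  by (induction K rule: infinite_finite_induct) auto

text \<open>For fixed \<open>x\<close> the form is linear in the matrix entries, so an entrywise
  identity of matrices passes to the forms.\<close>

lemma quad_form_sum:
  fixes B :: "'k \<Rightarrow> complex mat"
  assumes B: "\<And>k. k \<in> K \<Longrightarrow> B k \<in> carrier_mat n n" and M: "M \<in> carrier_mat n n"
    and sum: "\<And>i j. i < n \<Longrightarrow> j < n \<Longrightarrow> (\<Sum>k\<in>K. B k $$ (i, j)) = of_real c * M $$ (i, j)"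
    and x: "x \<in> carrier_vec n"
  shows "(\<Sum>k\<in>K. Re ((B k *\<^sub>v x) \<bullet>c x)) = c * Re ((M *\<^sub>v x) \<bullet>c x)"
proof -
  have form: "(A *\<^sub>v x) \<bullet>c x = (\<Sum>i<n. \<Sum>j<n. A $$ (i, j) * (x $ j * cnj (x $ i)))"
    if "A \<in> carrier_mat n n" for A
    using that x by (simp add: scalar_prod_def lessThan_atLeast0 sum_distrib_right mult.assoc)
  have "(\<Sum>k\<in>K. (B k *\<^sub>v x) \<bullet>c x) =
      (\<Sum>k\<in>K. \<Sum>i<n. \<Sum>j<n. B k $$ (i, j) * (x $ j * cnj (x $ i)))"
    using B by (intro sum.cong refl form)
  also have "\<dots> = (\<Sum>i<n. \<Sum>k\<in>K. \<Sum>j<n. B k $$ (i, j) * (x $ j * cnj (x $ i)))"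
    by (rule sum.swap)
  also have "\<dots> = (\<Sum>i<n. \<Sum>j<n. \<Sum>k\<in>K. B k $$ (i, j) * (x $ j * cnj (x $ i)))"
    by (intro sum.cong refl sum.swap)
  also have "\<dots> = (\<Sum>i<n. \<Sum>j<n. of_real c * (M $$ (i, j) * (x $ j * cnj (x $ i))))"
    by (intro sum.cong refl) (simp add: sum_distrib_right[symmetric] sum mult.assoc)
  also have "\<dots> = of_real c * ((M *\<^sub>v x) \<bullet>c x)"
    by (simp add: form[OF M] sum_distrib_left)
  finally show ?thesis by (simp flip: Re_sum)
qed

text \<open>Each bound tests both sides on one nonzero vector that avoids the unwanted eigenvectors
  of \<open>M\<close> and of every \<open>B k\<close>; the indices are such that at most
  \<open>n - 1\<close> constraints arise. The factor \<open>card K\<close> appears because each of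
  the \<open>card K\<close> forms is bounded by the same multiple of the squared norm.\<close>

theorem eigval_interlacing_sum:
  fixes B :: "'k \<Rightarrow> complex mat"
  assumes K: "finite K" "K \<noteq> {}" and c: "0 < c"
    and B: "\<And>k. k \<in> K \<Longrightarrow> B k \<in> carrier_mat n n" and HB: "\<And>k. k \<in> K \<Longrightarrow> hermitian_mat (B k)"
    and M: "M \<in> carrier_mat n n" and HM: "hermitian_mat M"
    and sum: "\<And>i j. i < n \<Longrightarrow> j < n \<Longrightarrow> (\<Sum>k\<in>K. B k $$ (i, j)) = of_real c * M $$ (i, j)"
    and l: "l < n"
  defines "X \<equiv> \<Sum>k\<in>K. eigvals_mset (B k)"
  shows "eigval l M \<le> card K / c * decreasing_list X ! l"
    and "card K / c * decreasing_list X ! (l + (card K * n - n)) \<le> eigval l M"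
proof -
  let ?N = "card K * n"
  let ?ann = "\<lambda>S x. x \<in> carrier_vec n \<and> (\<forall>w\<in>S. w \<bullet> x = 0)"
  have "size X = (\<Sum>k\<in>K. n)"
    unfolding X_def size_multiset_sum by (intro sum.cong refl size_eigvals_mset B)
  hence sizeX: "size X = ?N" by simp
  have "0 < card K" using K by (simp add: card_gt_0_iff)
  hence nN: "n \<le> ?N" by simp
  have sizeM: "size (eigvals_mset M) = n" by (rule size_eigvals_mset[OF M])
  \<comment> \<open>Strict positivity allows the squared norm to be cancelled at the end of both
    bounds.\<close>
  have pos: "0 < Re (x \<bullet>c x)" if "x \<in> carrier_vec n" "x \<noteq> 0\<^sub>v n" for x :: "complex vec"
    using conjugate_square_greater_0_vec[OF that(1)] that(2) by (simp add: less_complex_def)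
  show "eigval l M \<le> card K / c * decreasing_list X ! l"
  proof -
    define t s where "t = decreasing_list X ! l" and "s = eigval l M"
    have "\<exists>us. set us \<subseteq> carrier_vec n \<and>
        length us = (\<Sum>k\<in>K. size {#e \<in># eigvals_mset (B k). t < e#}) \<and>
        (\<forall>k\<in>K. \<forall>x. ?ann (set us) x \<longrightarrow> Re ((B k *\<^sub>v x) \<bullet>c x) \<le> t * Re (x \<bullet>c x))"
    proof (rule concat_choice[OF K(1)])
      fix k assume "k \<in> K"
      from hermitian_form_le[OF B[OF this] HB[OF this], of t]
      show "\<exists>us. set us \<subseteq> carrier_vec n \<and> length us = size {#e \<in># eigvals_mset (B k). t < e#} \<and>
          (\<forall>x. ?ann (set us) x \<longrightarrow> Re ((B k *\<^sub>v x) \<bullet>c x) \<le> t * Re (x \<bullet>c x))"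
        by metis
    qed blast
    then obtain us where us: "set us \<subseteq> carrier_vec n" "length us = size {#e \<in># X. t < e#}"
      "\<And>k x. k \<in> K \<Longrightarrow> ?ann (set us) x \<Longrightarrow> Re ((B k *\<^sub>v x) \<bullet>c x) \<le> t * Re (x \<bullet>c x)"
      unfolding X_def size_filter_mset_sum by blast
    obtain vs where vs: "set vs \<subseteq> carrier_vec n" "length vs = size {#e \<in># eigvals_mset M. e < s#}"
      "\<And>x. ?ann (set vs) x \<Longrightarrow> s * Re (x \<bullet>c x) \<le> Re ((M *\<^sub>v x) \<bullet>c x)"
      using hermitian_form_ge[OF M HM, of s] by metis
    have "length us \<le> l"
      using size_greater_decreasing_list_nth[of l X] l nN by (simp add: us(2) t_def sizeX)
    moreover have "length vs \<le> n - Suc l"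
      using size_less_decreasing_list_nth[of l "eigvals_mset M"] l
      by (simp add: vs(2) s_def eigval_def sizeM)
    \<comment> \<open>At most \<open>l + (n - 1 - l) = n - 1\<close> equations have been
      collected.\<close>
    ultimately have "length (us @ vs) < n" using l by simp
    with us(1) vs(1) obtain x where x: "x \<in> carrier_vec n" "x \<noteq> 0\<^sub>v n"
      "\<And>w. w \<in> set (us @ vs) \<Longrightarrow> w \<bullet> x = 0"
      using exists_nonzero_annihilated[of "us @ vs" n] by auto
    have "c * (s * Re (x \<bullet>c x)) \<le> c * Re ((M *\<^sub>v x) \<bullet>c x)"
      using vs(3) x c by (intro mult_left_mono) auto
    also have "\<dots> = (\<Sum>k\<in>K. Re ((B k *\<^sub>v x) \<bullet>c x))"
      using quad_form_sum[OF B M sum x(1)] by simp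
    also have "\<dots> \<le> (\<Sum>k\<in>K. t * Re (x \<bullet>c x))"
      using us(3) x by (intro sum_mono) auto
    finally have "(c * s) * Re (x \<bullet>c x) \<le> (card K * t) * Re (x \<bullet>c x)" by simp
    hence "c * s \<le> card K * t" using pos[OF x(1,2)] by simp
    thus ?thesis using c by (simp add: t_def s_def field_simps)
  qed
  show "card K / c * decreasing_list X ! (l + (?N - n)) \<le> eigval l M"
  proof -
    define t s where "t = decreasing_list X ! (l + (?N - n))" and "s = eigval l M"
    have "\<exists>us. set us \<subseteq> carrier_vec n \<and>
        length us = (\<Sum>k\<in>K. size {#e \<in># eigvals_mset (B k). e < t#}) \<and>
        (\<forall>k\<in>K. \<forall>x. ?ann (set us) x \<longrightarrow> t * Re (x \<bullet>c x) \<le> Re ((B k *\<^sub>v x) \<bullet>c x))"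
    proof (rule concat_choice[OF K(1)])
      fix k assume "k \<in> K"
      from hermitian_form_ge[OF B[OF this] HB[OF this], of t]
      show "\<exists>us. set us \<subseteq> carrier_vec n \<and> length us = size {#e \<in># eigvals_mset (B k). e < t#} \<and>
          (\<forall>x. ?ann (set us) x \<longrightarrow> t * Re (x \<bullet>c x) \<le> Re ((B k *\<^sub>v x) \<bullet>c x))"
        by metis
    qed blast
    then obtain us where us: "set us \<subseteq> carrier_vec n" "length us = size {#e \<in># X. e < t#}"
      "\<And>k x. k \<in> K \<Longrightarrow> ?ann (set us) x \<Longrightarrow> t * Re (x \<bullet>c x) \<le> Re ((B k *\<^sub>v x) \<bullet>c x)"
      unfolding X_def size_filter_mset_sum by blast
    obtain vs where vs: "set vs \<subseteq> carrier_vec n" "length vs = size {#e \<in># eigvals_mset M. s < e#}"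
      "\<And>x. ?ann (set vs) x \<Longrightarrow> Re ((M *\<^sub>v x) \<bullet>c x) \<le> s * Re (x \<bullet>c x)"
      using hermitian_form_le[OF M HM, of s] by metis
    \<comment> \<open>In the pooled list exactly \<open>n - 1 - l\<close> positions follow position
      \<open>l + (?N - n)\<close>. Together with the at most \<open>l\<close> eigenvalues of
      \<open>M\<close> above \<open>s\<close> this again gives at most \<open>n - 1\<close>
      equations.\<close>
    have "l + (?N - n) < ?N" using l nN by linarith
    hence "length us \<le> ?N - Suc (l + (?N - n))"
      using size_less_decreasing_list_nth[of "l + (?N - n)" X] by (simp add: us(2) t_def sizeX)
    moreover have "length vs \<le> l"
      using size_greater_decreasing_list_nth[of l "eigvals_mset M"] l
      by (simp add: vs(2) s_def eigval_def sizeM)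
    ultimately have "length (us @ vs) < n" using l nN unfolding length_append by linarith
    with us(1) vs(1) obtain x where x: "x \<in> carrier_vec n" "x \<noteq> 0\<^sub>v n"
      "\<And>w. w \<in> set (us @ vs) \<Longrightarrow> w \<bullet> x = 0"
      using exists_nonzero_annihilated[of "us @ vs" n] by auto
    have "(\<Sum>k\<in>K. t * Re (x \<bullet>c x)) \<le> (\<Sum>k\<in>K. Re ((B k *\<^sub>v x) \<bullet>c x))"
      using us(3) x by (intro sum_mono) auto
    also have "\<dots> = c * Re ((M *\<^sub>v x) \<bullet>c x)"
      using quad_form_sum[OF B M sum x(1)] by simp
    also have "\<dots> \<le> c * (s * Re (x \<bullet>c x))"
      using vs(3) x c by (intro mult_left_mono) auto
    finally have "(card K * t) * Re (x \<bullet>c x) \<le> (c * s) * Re (x \<bullet>c x)" by simp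
    hence "card K * t \<le> c * s" using pos[OF x(1,2)] by simp
    thus ?thesis using c by (simp add: t_def s_def field_simps)
  qed
qed

section \<open>Cyclic shifts of a graceful mask\<close>

lemma cyclic_mat_carrier [simp]: "cyclic_mat n \<in> carrier_mat n n"
  by (simp add: cyclic_mat_def)

lemma index_mult_mat_sum:
  assumes "A \<in> carrier_mat nr n" "B \<in> carrier_mat n nc" "i < nr" "j < nc"
  shows "(A * B) $$ (i, j) = (\<Sum>r<n. A $$ (i, r) * B $$ (r, j))"
  using assms by (simp add: scalar_prod_def lessThan_atLeast0)

text \<open>On naturals \<open>n - k mod n\<close> acts as the negative of \<open>k\<close> modulo
  \<open>n\<close>, for \<open>k\<close> of any size.\<close>

lemma mod_add_minus_mod:
  fixes i k n :: nat
  assumes "i < n"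
  shows "((i + k) mod n + (n - k mod n)) mod n = i"
    and "((i + (n - k mod n)) mod n + k) mod n = i"
proof -
  have k: "k mod n < n" using assms by simp
  have "((i + k) mod n + (n - k mod n)) mod n = (i + k mod n + (n - k mod n)) mod n"
    by (subst mod_add_right_eq[of i k, symmetric], rule mod_add_left_eq)
  also have "i + k mod n + (n - k mod n) = i + n" using k by linarith
  finally show "((i + k) mod n + (n - k mod n)) mod n = i" using assms by simp
  have "((i + (n - k mod n)) mod n + k) mod n = (i + (n - k mod n) + k mod n) mod n"
    by (subst mod_add_left_eq, rule mod_add_right_eq[symmetric])
  also have "i + (n - k mod n) + k mod n = i + n" using k by linarith
  finally show "((i + (n - k mod n)) mod n + k) mod n = i" using assms by simp
qed

text \<open>The power maps the unit vector at \<open>j\<close> to the one at \<open>j + k\<close>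
  modulo \<open>n\<close>. Peeling off the last factor replaces \<open>j\<close> by its successor,
  so the induction must generalize over \<open>j\<close>.\<close>

lemma cyclic_mat_pow_index:
  assumes "i < n" "j < n"
  shows "(cyclic_mat n ^\<^sub>m k) $$ (i, j) = (if i = (j + k) mod n then 1 else 0)"
  using assms
proof (induction k arbitrary: i j)
  case 0
  thus ?case by (simp add: cyclic_mat_def)
next
  case (Suc k)
  let ?P = "cyclic_mat n ^\<^sub>m k"
  have "?P \<in> carrier_mat n n" by simp
  from index_mult_mat_sum[OF this cyclic_mat_carrier Suc.prems]
  have "(cyclic_mat n ^\<^sub>m Suc k) $$ (i, j) = (\<Sum>r<n. ?P $$ (i, r) * cyclic_mat n $$ (r, j))"
    by simp
  also have "\<dots> = (\<Sum>r<n. if r = (j + 1) mod n then ?P $$ (i, (j + 1) mod n) else 0)"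
    using Suc.prems by (intro sum.cong refl) (simp add: cyclic_mat_def)
  also have "\<dots> = ?P $$ (i, (j + 1) mod n)" using Suc.prems by simp
  also have "\<dots> = (if i = ((j + 1) mod n + k) mod n then 1 else 0)"
    using Suc.prems by (intro Suc.IH) auto
  also have "((j + 1) mod n + k) mod n = (j + Suc k) mod n"
    by (simp add: mod_add_left_eq)
  finally show ?case .
qed

text \<open>The inverse need not be computed: the conjugate \<open>Y\<close> satisfies
  \<open>Y * ?P = ?P * X\<close>, and comparing the entries at \<open>((i + k) mod n, j)\<close>
  isolates one entry of \<open>Y\<close> and one of \<open>X\<close>.\<close>

lemma cyclic_mat_conj_index:
  assumes X: "X \<in> carrier_mat n n" and ij: "i < n" "j < n"
  shows "(cyclic_mat n ^\<^sub>m k * X * the (mat_inverse (cyclic_mat n ^\<^sub>m k))) $$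
    ((i + k) mod n, (j + k) mod n) = X $$ (i, j)"
proof -
  let ?P = "cyclic_mat n ^\<^sub>m k"
  have P: "?P \<in> carrier_mat n n" by simp
  obtain B where B: "mat_inverse ?P = Some B" "B \<in> carrier_mat n n" "B * ?P = 1\<^sub>m n"
    using cyclic_mat_pow_inverse by blast
  define Y where "Y = ?P * X * B"
  have PX: "?P * X \<in> carrier_mat n n" by (rule mult_carrier_mat[OF P X])
  have Y: "Y \<in> carrier_mat n n" unfolding Y_def by (rule mult_carrier_mat[OF PX B(2)])
  have "Y * ?P = ?P * X * (B * ?P)"
    unfolding Y_def by (rule assoc_mult_mat[OF PX B(2) P])
  hence YP: "Y * ?P = ?P * X" unfolding B(3) right_mult_one_mat[OF PX] .
  let ?i = "(i + k) mod n" and ?j = "(j + k) mod n"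
  have inj: "?i = (r + k) mod n \<longleftrightarrow> r = i" if "r < n" for r
    using that ij mod_add_minus_mod(1)[of r n k] mod_add_minus_mod(1)[of i n k] by metis
  have n: "?i < n" "?j < n" using ij by auto
  have "(Y * ?P) $$ (?i, j) = (\<Sum>r<n. Y $$ (?i, r) * ?P $$ (r, j))"
    by (rule index_mult_mat_sum[OF Y P n(1) ij(2)])
  also have "\<dots> = (\<Sum>r<n. if r = ?j then Y $$ (?i, ?j) else 0)"
    using ij by (intro sum.cong refl) (simp add: cyclic_mat_pow_index)
  also have "\<dots> = Y $$ (?i, ?j)" using n by simp
  finally have "Y $$ (?i, ?j) = (?P * X) $$ (?i, j)" using YP by simp
  also have "\<dots> = (\<Sum>r<n. ?P $$ (?i, r) * X $$ (r, j))"
    by (rule index_mult_mat_sum[OF P X n(1) ij(2)])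
  also have "\<dots> = (\<Sum>r<n. if r = i then X $$ (i, j) else 0)"
    using n by (intro sum.cong refl) (simp add: cyclic_mat_pow_index inj)
  also have "\<dots> = X $$ (i, j)" using ij by simp
  finally show ?thesis by (simp add: Y_def B(1))
qed

text \<open>Adding \<open>n\<close> first keeps natural subtraction from truncating; the result is
  the residue of \<open>p - k\<close>.\<close>

lemma mod_add_diff:
  fixes p k n :: nat
  assumes "p < n" "k < n"
  shows "(p + n - k) mod n = (if k \<le> p then p - k else p + n - k)"
proof (cases "k \<le> p")
  case True
  hence "p + n - k = (p - k) + n" by simp
  hence "(p + n - k) mod n = (p - k) mod n" by (simp only: mod_add_self2)
  thus ?thesis using True assms by simp
qed (use assms in simp)

section \<open>Cyclic diagonals of a graceful labelling\<close>

lemma graceful_unique_edge: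
  assumes "graceful_loop_graph n E" "d < n"
  shows "\<exists>!i. i < n - d \<and> {i, i + d} \<in> E"
proof -
  have bij: "bij_betw edge_label E {0..n - 1}" and lg: "loop_graph n E"
    using assms by (auto simp: graceful_loop_graph_def)
  have label: "edge_label {i, i + d} = d" for i by (simp add: edge_label_def)
  \<comment> \<open>Existence: the label \<open>d\<close> is attained, and the smaller endpoint of
    such an edge is the witness. For \<open>d = 0\<close> the edge is the loop.\<close>
  have "d \<in> edge_label ` E" using bij assms(2) by (auto simp: bij_betw_def)
  then obtain e where e: "e \<in> E" "edge_label e = d" by auto
  with lg obtain a b where ab: "a < n" "b < n" "e = {a, b}" by (auto simp: loop_graph_def)
  hence "d = max a b - min a b" using e by (simp add: edge_label_def)
  hence "min a b < n - d" "{min a b, min a b + d} \<in> E"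
    using ab e(1) insert_commute[of a b] by (auto simp: min_def max_def)
  \<comment> \<open>Uniqueness: labels are injective on edges, and two equal pairs with the same gap
    have the same smaller endpoint.\<close>
  moreover have "i = j" if "{i, i + d} \<in> E" "{j, j + d} \<in> E" for i j
  proof -
    have "{i, i + d} = {j, j + d}"
      using bij that label by (auto simp: bij_betw_def inj_on_def)
    thus ?thesis by (auto simp: doubleton_eq_iff)
  qed
  ultimately show ?thesis by (intro ex1I[of _ "min a b"]) auto
qed

definition adj :: "nat set set \<Rightarrow> nat \<Rightarrow> nat \<Rightarrow> complex" where
  "adj E i j = (if {i, j} \<in> E then 1 else 0)"

lemma adj_commute: "adj E i j = adj E j i"
  by (simp add: adj_def insert_commute)

lemma sum_adj_superdiagonal:
  assumes "graceful_loop_graph n E" "d < n"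
  shows "(\<Sum>i<n - d. adj E i (i + d)) = 1"
proof -
  obtain i where i: "i < n - d" "{i, i + d} \<in> E"
    and u: "\<And>j. j < n - d \<Longrightarrow> {j, j + d} \<in> E \<Longrightarrow> j = i"
    using graceful_unique_edge[OF assms] by blast
  have "(\<Sum>j<n - d. adj E j (j + d)) = (\<Sum>j<n - d. if j = i then 1 else 0)"
    using i by (intro sum.cong refl) (auto simp: adj_def dest: u)
  thus ?thesis using i by simp
qed

text \<open>For nonzero \<open>d\<close> the cyclic diagonal splits at \<open>n - d\<close> into the
  superdiagonal of offset \<open>d\<close> and a wrapped piece, the transpose of the superdiagonal
  of offset \<open>n - d\<close>. Each contributes 1; if \<open>n = 2 * d\<close>, the same edge is
  counted from both of its ends.\<close>

lemma sum_adj_cyclic_diagonal: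
  assumes g: "graceful_loop_graph n E" and d: "d < n"
  shows "(\<Sum>i<n. adj E i ((i + d) mod n)) = (if d = 0 then 1 else 2)"
proof (cases "d = 0")
  case True
  thus ?thesis using sum_adj_superdiagonal[OF g d] by simp
next
  case False
  have "(\<Sum>i<n. adj E i ((i + d) mod n)) =
      (\<Sum>i<n - d. adj E i ((i + d) mod n)) + (\<Sum>i=n - d..<n. adj E i ((i + d) mod n))"
    using sum.atLeastLessThan_concat[of 0 "n - d" n "\<lambda>i. adj E i ((i + d) mod n)"]
    by (simp add: lessThan_atLeast0)
  also have "(\<Sum>i<n - d. adj E i ((i + d) mod n)) = (\<Sum>i<n - d. adj E i (i + d))"
    by (intro sum.cong refl) simp
  also have "\<dots> = 1" by (rule sum_adj_superdiagonal[OF g d])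
  \<comment> \<open>With \<open>j = i - (n - d)\<close> the wrapped column index is
    \<open>j\<close>; symmetry of \<open>adj\<close> then puts the smaller index first.\<close>
  also have "(\<Sum>i=n - d..<n. adj E i ((i + d) mod n)) = (\<Sum>j<n - (n - d). adj E j (j + (n - d)))"
  proof (rule sum.reindex_bij_witness[of _ "\<lambda>j. j + (n - d)" "\<lambda>i. i - (n - d)"])
    fix i assume i: "i \<in> {n - d..<n}"
    hence "n - d \<le> i" by simp
    hence "i + d = (i - (n - d)) + n" using d by linarith
    hence "(i + d) mod n = (i - (n - d)) mod n" by (simp only: mod_add_self2)
    also have "\<dots> = i - (n - d)" using i by (intro mod_less) (simp add: less_imp_diff_less)
    finally show "adj E (i - (n - d)) (i - (n - d) + (n - d)) = adj E i ((i + d) mod n)"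
      using i by (simp add: adj_commute[of E i])
  qed (use d in auto)
  also have "\<dots> = 1" by (rule sum_adj_superdiagonal[OF g]) (use False d in auto)
  finally show ?thesis using False by simp
qed

text \<open>The unshifted mask. The summand \<open>1\<^sub>m n\<close> doubles the loop, whose
  diagonal entry becomes -1; this compensates for the loop lying only once on the main diagonal,
  while every other cyclic diagonal meets two adjacency entries.\<close>

definition loop_mask :: "nat \<Rightarrow> nat set set \<Rightarrow> complex mat" where
  "loop_mask n E = ones_mat n - adjacency_mat n E \<circ>\<^sub>m (ones_mat n + 1\<^sub>m n)"

lemma loop_mask_carrier [simp]: "loop_mask n E \<in> carrier_mat n n"
  by (intro carrier_matI) (simp_all add: loop_mask_def adjacency_mat_def entrywise_prod_def)

lemma loop_mask_index:
  "i < n \<Longrightarrow> j < n \<Longrightarrow> loop_mask n E $$ (i, j) = 1 - adj E i j * (if i = j then 2 else 1)"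
  by (simp add: loop_mask_def ones_mat_def adjacency_mat_def entrywise_prod_def adj_def)

lemma masked_mat_carrier [simp]: "M \<in> carrier_mat n n \<Longrightarrow> masked_mat n E M k \<in> carrier_mat n n"
  by (auto simp: masked_mat_def entrywise_prod_def)

text \<open>Stated at shifted positions, so that no subtraction modulo \<open>n\<close>
  enters.\<close>

lemma masked_mat_index:
  assumes M: "M \<in> carrier_mat n n" and ij: "i < n" "j < n"
  shows "masked_mat n E M k $$ ((i + k) mod n, (j + k) mod n) =
    M $$ ((i + k) mod n, (j + k) mod n) * loop_mask n E $$ (i, j)"
  using M ij cyclic_mat_conj_index[OF loop_mask_carrier ij, of k E]
  by (simp add: masked_mat_def entrywise_prod_def loop_mask_def)

text \<open>The mask is real and symmetric, and shifting both indices by the same amount preserves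
  this.\<close>

lemma hermitian_masked_mat:
  assumes M: "M \<in> carrier_mat n n" and H: "hermitian_mat M"
  shows "hermitian_mat (masked_mat n E M k)"
proof (rule hermitian_matI)
  show "masked_mat n E M k \<in> carrier_mat n n" using M by simp
  fix p q assume pq: "p < n" "q < n"
  \<comment> \<open>\<open>i\<close> and \<open>j\<close> are \<open>p\<close> and \<open>q\<close>
    shifted back by \<open>k\<close>, which brings the entries into the form of
    \<open>masked_mat_index\<close>.\<close>
  define i where "i = (p + (n - k mod n)) mod n"
  define j where "j = (q + (n - k mod n)) mod n"
  have i: "i < n" "p = (i + k) mod n" and j: "j < n" "q = (j + k) mod n"
    using pq mod_add_minus_mod(2)[of p n k] mod_add_minus_mod(2)[of q n k] unfolding i_def j_def by auto
  have "masked_mat n E M k $$ (p, q) = M $$ (p, q) * loop_mask n E $$ (i, j)"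
    using masked_mat_index[OF M i(1) j(1)] i j by simp
  moreover have "masked_mat n E M k $$ (q, p) = M $$ (q, p) * loop_mask n E $$ (j, i)"
    using masked_mat_index[OF M j(1) i(1)] i j by simp
  moreover have "M $$ (p, q) = cnj (M $$ (q, p))"
    by (rule hermitian_mat_index[OF H M pq])
  moreover have "loop_mask n E $$ (i, j) = cnj (loop_mask n E $$ (j, i))"
    using i j by (simp add: loop_mask_index adj_def insert_commute)
  ultimately show "masked_mat n E M k $$ (p, q) = cnj (masked_mat n E M k $$ (q, p))"
    by simp
qed

text \<open>As \<open>k\<close> runs through all shifts, the position \<open>(p, q)\<close> meets
  each mask entry of the cyclic diagonal \<open>d = q - p\<close> modulo \<open>n\<close> exactly
  once. These sum to \<open>n - 1 * 2\<close> for \<open>d = 0\<close> and to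
  \<open>n - 2 * 1\<close> otherwise.\<close>

lemma sum_masked_mat_index:
  assumes g: "graceful_loop_graph n E" and M: "M \<in> carrier_mat n n" and pq: "p < n" "q < n"
  shows "(\<Sum>k<n. masked_mat n E M k $$ (p, q)) = of_real (real n - 2) * M $$ (p, q)"
proof -
  define d where "d = (q + n - p) mod n"
  have d: "d < n" using pq by (simp add: d_def)
  let ?s = "\<lambda>k. (p + n - k) mod n"
  have entry: "masked_mat n E M k $$ (p, q) = M $$ (p, q) * loop_mask n E $$ (?s k, (?s k + d) mod n)"
    if k: "k < n" for k
  proof -
    have p: "(?s k + k) mod n = p"
      using pq k by (simp add: mod_add_diff)
    have "((?s k + d) mod n + k) mod n = (?s k + d + k) mod n"
      by (rule mod_add_left_eq)
    also have "\<dots> = (?s k + k + d) mod n" by (simp only: add_ac)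
    also have "\<dots> = ((?s k + k) mod n + d) mod n" by (rule mod_add_left_eq[symmetric])
    also have "\<dots> = q" unfolding p d_def using pq by (simp add: mod_add_diff)
    finally have q: "((?s k + d) mod n + k) mod n = q" .
    have "?s k < n" "(?s k + d) mod n < n" using pq by auto
    from masked_mat_index[OF M this, of E k] show ?thesis unfolding p q .
  qed
  have "(\<Sum>k<n. masked_mat n E M k $$ (p, q)) =
      (\<Sum>k<n. M $$ (p, q) * loop_mask n E $$ (?s k, (?s k + d) mod n))"
    by (intro sum.cong refl entry) auto
  \<comment> \<open>The map \<open>?s\<close>, reflection \<open>k\<close> to \<open>p - k\<close>
    modulo \<open>n\<close>, is an involution of the index range and so serves as its own inverse in
    the reindexing.\<close>
  also have "\<dots> = (\<Sum>i<n. M $$ (p, q) * loop_mask n E $$ (i, (i + d) mod n))"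
    using pq by (intro sum.reindex_bij_witness[of _ ?s ?s]) (auto simp: mod_add_diff)
  also have "\<dots> = M $$ (p, q) * (\<Sum>i<n. loop_mask n E $$ (i, (i + d) mod n))"
    by (simp add: sum_distrib_left)
  also have "(\<Sum>i<n. loop_mask n E $$ (i, (i + d) mod n)) =
      (\<Sum>i<n. 1 - adj E i ((i + d) mod n) * (if d = 0 then 2 else 1))"
  proof (intro sum.cong refl)
    fix i assume "i \<in> {..<n}"
    \<comment> \<open>A cyclic diagonal lies wholly on the main diagonal or wholly off it, so the
      factor 2 is constant along it.\<close>
    moreover from this have "i = (i + d) mod n \<longleftrightarrow> d = 0"
      using d by (auto simp: mod_if)
    ultimately show "loop_mask n E $$ (i, (i + d) mod n) =
        1 - adj E i ((i + d) mod n) * (if d = 0 then 2 else 1)"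
      by (subst loop_mask_index) auto
  qed
  also have "\<dots> = of_nat n - (\<Sum>i<n. adj E i ((i + d) mod n)) * (if d = 0 then 2 else 1)"
    by (simp add: sum_subtractf sum_distrib_right)
  also have "\<dots> = of_real (real n - 2)"
    by (simp add: sum_adj_cyclic_diagonal[OF g d])
  finally show ?thesis by (simp add: mult.commute)
qed

theorem theorem6p5:
  fixes n l :: nat and E :: "nat set set" and M :: "complex mat"
  assumes "n \<ge> 4"
    and "graceful_loop_graph n E"
    and "M \<in> carrier_mat n n" and "hermitian_mat M"
    and "l < n"
  shows "real n / (real n - 2) * pooled_eigval n E M (l + (n\<^sup>2 - n)) \<le> eigval l M \<and>
         eigval l M \<le> real n / (real n - 2) * pooled_eigval n E M l"
proof -
  have "{..<n} \<noteq> {}" "0 < real n - 2" using assms(1) by (auto simp: lessThan_empty_iff)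
  \<comment> \<open>The index set is the set of \<open>n\<close> shifts and \<open>c\<close> is
    \<open>n - 2\<close>, so the pooled list has \<open>n * n\<close> entries.\<close>
  note eigval_interlacing_sum[OF finite_lessThan this masked_mat_carrier[OF assms(3)]
      hermitian_masked_mat[OF assms(3,4)] assms(3,4)
      sum_masked_mat_index[OF assms(2,3)] assms(5)]
  thus ?thesis by (simp add: pooled_eigval_def power2_eq_square)
qed

end
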